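(* Let $\mu>0$ be a constant, let $n\geq 2$ be an integer, and let $1\leq p<n$. Then there are infinitely many non-trivial (i.e. not identically zero) $L^p$-acceptable solutions $\mathbf{u}:(0,\infty)\times\mathbb{R}^n\to\mathbb{R}^n$ to the Cauchy problem for the Cole system $$\mathbf{u}_t+(\mathbf{u}\cdot\nabla)\mathbf{u}=\mu\Delta\mathbf{u}$$ with vanishing initial data $\mathbf{u}_0\equiv\mathbf{0}$.
   Context: For $\mathbf{u}=(u_1,\dots,u_n)^T$ depending on $(t,\mathbf{x})$ with $t>0$, $\mathbf{x}\in\mathbb{R}^n$, one sets $(\mathbf{u}\cdot\nabla)\mathbf{u}:=(D_{\mathbf{x}}\mathbf{u})\,\mathbf{u}$, where $D_{\mathbf{x}}\mathbf{u}$ is the Jacobian matrix of $\mathbf{u}$ with respect to $\mathbf{x}$; $\Delta$ is the Laplacian in $\mathbf{x}$, acting component-wise. The constant $\mu>0$ is fixed. Definition ($L^p$-acceptable solution). Given a measurable function $\mathbf{u}_0:\mathbb{R}^n\to\mathbb{R}^n$ and $p\geq1$, a function $\mathbf{u}:(0,\infty)\times\mathbb{R}^n\to\mathbb{R}^n$ is an $L^p$-acceptable solution to the Cauchy problem for the Cole system with initial data $\mathbf{u}_0$ provided: (i) $\mathbf{u}_t$, $D_{\mathbf{x}}\mathbf{u}$, $\Delta\mathbf{u}$ exist and are continuous on $(0,\infty)\times\mathbb{R}^n$; (ii) $\mathbf{u}$ satisfies $\mathbf{u}_t+(\mathbf{u}\cdot\nabla)\mathbf{u}=\mu\Delta\mathbf{u}$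 classically at all points $(t,\mathbf{x})\in(0,\infty)\times\mathbb{R}^n$; (iii) $\mathbf{u}(t)\to\mathbf{u}_0$ in $L^p(\mathbb{R}^n)$ as $t\to0+$, i.e. $\int_{\mathbb{R}^n}|\mathbf{u}(t,\mathbf{x})-\mathbf{u}_0(\mathbf{x})|^p\,d\mathbf{x}\to0$, where $|\cdot|$ is the Euclidean norm. *)

theory Defs
  imports "HOL-Analysis.Analysis"
begin

definition partial_deriv :: "'n::finite \<Rightarrow> (real ^ 'n \<Rightarrow> real) \<Rightarrow> real ^ 'n \<Rightarrow> real" where
  "partial_deriv i g x = deriv (\<lambda>s. g (x + s *\<^sub>R axis i 1)) 0"

definition partial_deriv_exists :: "'n::finite \<Rightarrow> (real ^ 'n \<Rightarrow> real) \<Rightarrow> real ^ 'n \<Rightarrow> bool" where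
  "partial_deriv_exists i g x \<longleftrightarrow> (\<lambda>s. g (x + s *\<^sub>R axis i 1)) field_differentiable (at 0)"

definition laplacian :: "(real ^ 'n::finite \<Rightarrow> real ^ 'n) \<Rightarrow> real ^ 'n \<Rightarrow> real ^ 'n" where
  "laplacian v x = (\<chi> j. \<Sum>i\<in>UNIV. partial_deriv i (partial_deriv i (\<lambda>y. v y $ j)) x)"

text \<open>Only the pure second-order partial derivatives enter the Laplacian, so no mixed
  derivatives are required to exist.\<close>

definition laplacian_exists :: "(real ^ 'n::finite \<Rightarrow> real ^ 'n) \<Rightarrow> bool" where
  "laplacian_exists v \<longleftrightarrow> (\<forall>x i j. partial_deriv_exists i (\<lambda>y. v y $ j) x
      \<and> partial_deriv_exists i (partial_deriv i (\<lambda>y. v y $ j)) x)"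

text \<open>A function on \<open>(0,\<infinity>) \<times> \<real>\<^sup>n\<close> is given in curried form; nothing below depends on its values
  at times \<open>t \<le> 0\<close>. Convergence in \<open>L\<^sup>p\<close> uses the nonnegative integral, since the Bochner
  integral of a non-integrable function is \<open>0\<close>.\<close>

definition Lp_acceptable_solution ::
  "real \<Rightarrow> real \<Rightarrow> (real ^ 'n::finite \<Rightarrow> real ^ 'n) \<Rightarrow> (real \<Rightarrow> real ^ 'n \<Rightarrow> real ^ 'n) \<Rightarrow> bool" where
  "Lp_acceptable_solution \<mu> p u0 u \<longleftrightarrow>
     u0 \<in> borel_measurable lebesgue \<and> 1 \<le> p \<and>
     (\<forall>t>0. \<forall>x. (\<lambda>s. u s x) differentiable (at t)) \<and>
     continuous_on ({0<..} \<times> UNIV) (\<lambda>(t, x). vector_derivative (\<lambda>s. u s x) (at t)) \<and>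
     (\<forall>t>0. \<forall>x. u t differentiable (at x)) \<and>
     continuous_on ({0<..} \<times> UNIV) (\<lambda>(t, x). jacobian (u t) (at x)) \<and>
     (\<forall>t>0. laplacian_exists (u t)) \<and>
     continuous_on ({0<..} \<times> UNIV) (\<lambda>(t, x). laplacian (u t) x) \<and>
     (\<forall>t>0. \<forall>x. vector_derivative (\<lambda>s. u s x) (at t) + jacobian (u t) (at x) *v u t x
        = \<mu> *\<^sub>R laplacian (u t) x) \<and>
     ((\<lambda>t. \<integral>\<^sup>+x. ennreal (norm (u t x - u0 x) powr p) \<partial>lebesgue) \<longlongrightarrow> 0) (at_right 0)"

end

theory Submission
  imports Defs "HOL-Probability.Distributions"
begin

text \<open>
  The solutions come from the Cole--Hopf transformation: if a positive function \<open>\<phi>\<close> solves the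
  heat equation \<open>\<phi>\<^sub>t = \<mu>\<Delta>\<phi>\<close>, then \<open>u = -2\<mu> \<nabla>\<phi> / \<phi>\<close> solves the Cole system, because a
  gradient field satisfies \<open>(u \<bullet> \<nabla>)u = \<nabla>(\<bar>u\<bar>\<^sup>2 / 2)\<close>. For \<open>\<phi>\<close> take the constant \<open>1\<close> plus a
  multiple of the heat kernel, \<open>\<phi> = 1 + t powr (-n/2) * exp (-\<bar>x\<bar>\<^sup>2/(4\<mu>t)) / C\<close> with \<open>C > 0\<close>.
  The initial datum of \<open>\<phi>\<close> is \<open>1\<close> plus a point mass at the origin; the point mass contributes
  nothing to the \<open>L\<^sup>p\<close> limit of \<open>u\<close> when \<open>p < n\<close>, and different values of \<open>C\<close> give different
  solutions. Explicitly,
  \<open>u(t,x) = x / (t * (1 + h))\<close> with \<open>h = C * t powr (n/2) * exp (\<bar>x\<bar>\<^sup>2/(4\<mu>t))\<close>.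

  The Cole system is verified on this formula. It has the radial form \<open>u(t,x) = F(t,\<bar>x\<bar>\<^sup>2) x\<close>, for
  which Jacobian and Laplacian are explicit (\<open>radial_jacobian\<close>, \<open>radial_laplacian\<close>), so the
  system reduces to one scalar equation for \<open>F\<close> in the variables \<open>t\<close> and \<open>q = \<bar>x\<bar>\<^sup>2\<close>
  (\<open>cole_profile_equation\<close>).

  For the initial condition, interpolate \<open>1 + h \<ge> h powr \<theta>\<close> with \<open>0 < \<theta> \<le> 1\<close>. This leaves a
  Gaussian factor \<open>exp (-\<theta>\<bar>x\<bar>\<^sup>2/(4\<mu>t))\<close>, and since \<open>x\<close> scales like \<open>sqrt t\<close> under it,
  \<open>\<integral>\<bar>u\<bar>\<^sup>p dx\<close> is at most a constant times \<open>t powr ((n - p - n\<theta>p)/2)\<close>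
  (\<open>cole_field_Lp_bound\<close>). The exponent is positive for small \<open>\<theta>\<close> exactly because \<open>p < n\<close>.
\<close>

section \<open>Calculus of radial vector fields\<close>

text \<open>
  Along a coordinate line the squared norm is a quadratic polynomial in the line parameter, which
  turns every partial derivative of a radial field into a one-variable chain rule.
\<close>

lemma line_inner:
  fixes x :: "real ^ 'n::finite"
  shows "(x + s *\<^sub>R axis i 1) \<bullet> (x + s *\<^sub>R axis i 1) = x \<bullet> x + 2 * s * x $ i + s^2"
  by (simp add: inner_add_left inner_add_right inner_axis inner_axis' power2_eq_square algebra_simps)

lemma radial_has_derivative:
  fixes x :: "real ^ 'n::finite"
  assumes "(f has_real_derivative f') (at (x \<bullet> x))"
  shows "((\<lambda>y. f (y \<bullet> y) *\<^sub>R y) has_derivative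
           (\<lambda>h. f (x \<bullet> x) *\<^sub>R h + (2 * f' * (x \<bullet> h)) *\<^sub>R x)) (at x)"
proof -
  have "((\<lambda>y. y \<bullet> y) has_derivative (\<lambda>h. 2 * (x \<bullet> h))) (at x)"
    by (auto intro!: derivative_eq_intros simp: inner_commute)
  from has_derivative_compose[OF this, of f "(*) f'"] assms
  have "((\<lambda>y. f (y \<bullet> y)) has_derivative (\<lambda>h. f' * (2 * (x \<bullet> h)))) (at x)"
    by (simp add: has_field_derivative_def)
  from has_derivative_scaleR[OF this has_derivative_ident]
  show ?thesis by (simp add: mult_ac)
qed

lemma radial_jacobian:
  fixes x :: "real ^ 'n::finite"
  assumes "(f has_real_derivative f') (at (x \<bullet> x))"
  shows "jacobian (\<lambda>y. f (y \<bullet> y) *\<^sub>R y) (at x)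
           = (\<chi> j i. f (x \<bullet> x) * axis i 1 $ j + 2 * f' * x $ i * x $ j)"
  unfolding jacobian_def frechet_derivative_at[OF radial_has_derivative[OF assms], symmetric]
  by (simp add: matrix_def inner_axis vec_eq_iff)

lemma radial_jacobian_mult:
  fixes x :: "real ^ 'n::finite"
  assumes "(f has_real_derivative f') (at (x \<bullet> x))"
  shows "jacobian (\<lambda>y. f (y \<bullet> y) *\<^sub>R y) (at x) *v h
           = f (x \<bullet> x) *\<^sub>R h + (2 * f' * (x \<bullet> h)) *\<^sub>R x"
proof -
  note D = radial_has_derivative[OF assms]
  have "(\<lambda>y. f (y \<bullet> y) *\<^sub>R y) differentiable (at x)"
    using D by (auto simp: differentiable_def)
  then have "((\<lambda>y. f (y \<bullet> y) *\<^sub>R y) has_derivative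
      (\<lambda>h. jacobian (\<lambda>y. f (y \<bullet> y) *\<^sub>R y) (at x) *v h)) (at x)"
    by (simp add: jacobian_works)
  from has_derivative_unique[OF this D] show ?thesis by metis
qed

lemma radial_line_derivative:
  fixes x :: "real ^ 'n::finite"
  assumes "(f has_real_derivative f') (at (x \<bullet> x))"
  shows "((\<lambda>s. f ((x + s *\<^sub>R axis i 1) \<bullet> (x + s *\<^sub>R axis i 1))) has_real_derivative 2 * f' * x $ i) (at 0)"
proof -
  have "((\<lambda>s. x \<bullet> x + 2 * s * x $ i + s^2) has_real_derivative 2 * x $ i) (at 0)"
    by (auto intro!: derivative_eq_intros)
  moreover have "(f has_real_derivative f') (at (x \<bullet> x + 2 * 0 * x $ i + 0^2))"
    using assms by simp
  ultimately show ?thesis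
    unfolding line_inner using DERIV_chain2[of f f' "\<lambda>s. x \<bullet> x + 2 * s * x $ i + s^2" 0 "2 * x $ i" UNIV]
    by (simp add: mult_ac)
qed

lemma coordinate_line_derivative:
  fixes x :: "real ^ 'n::finite"
  shows "((\<lambda>s. (x + s *\<^sub>R axis i 1) $ j) has_real_derivative axis i 1 $ j) (at 0)"
  by (auto intro!: derivative_eq_intros)

lemma radial_first_partial:
  fixes x :: "real ^ 'n::finite"
  assumes "(f has_real_derivative f') (at (x \<bullet> x))"
  shows "((\<lambda>s. (\<lambda>y. (f (y \<bullet> y) *\<^sub>R y) $ j) (x + s *\<^sub>R axis i 1)) has_real_derivative
           2 * f' * x $ i * x $ j + f (x \<bullet> x) * axis i 1 $ j) (at 0)"
proof -
  from DERIV_mult[OF radial_line_derivative[OF assms, of i] coordinate_line_derivative[of x i j]]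
  show ?thesis by (simp add: algebra_simps)
qed

text \<open>
  The function differentiated here is the first partial derivative from \<open>radial_first_partial\<close>,
  with \<open>f'\<close> extended to the function \<open>g\<close>.
\<close>

lemma radial_second_partial:
  fixes x :: "real ^ 'n::finite"
  assumes "(f has_real_derivative f') (at (x \<bullet> x))" "(g has_real_derivative g') (at (x \<bullet> x))"
  shows "((\<lambda>s. (\<lambda>y. 2 * g (y \<bullet> y) * y $ i * y $ j + f (y \<bullet> y) * axis i 1 $ j) (x + s *\<^sub>R axis i 1))
            has_real_derivative
           4 * g' * (x $ i)^2 * x $ j + 2 * g (x \<bullet> x) * (x $ j + x $ i * axis i 1 $ j)
             + 2 * f' * x $ i * axis i 1 $ j) (at 0)"
proof -
  note F = radial_line_derivative[OF assms(1), of i] and G = radial_line_derivative[OF assms(2), of i]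
    and X = coordinate_line_derivative[of x i]
  show ?thesis
    by (rule derivative_eq_intros F G X refl | simp add: algebra_simps power2_eq_square)+
qed

lemma
  fixes f f' f'' :: "real \<Rightarrow> real"
  assumes f: "\<And>q. (f has_real_derivative f' q) (at q)"
    and f': "\<And>q. (f' has_real_derivative f'' q) (at q)"
  shows radial_laplacian_exists: "laplacian_exists (\<lambda>y::real ^ 'n::finite. f (y \<bullet> y) *\<^sub>R y)" (is ?E)
    and radial_laplacian: "laplacian (\<lambda>y::real ^ 'n. f (y \<bullet> y) *\<^sub>R y) x
      = (4 * (x \<bullet> x) * f'' (x \<bullet> x) + (2 * real CARD('n) + 4) * f' (x \<bullet> x)) *\<^sub>R x" (is ?L)
proof -
  note D1 = radial_first_partial[OF f] and D2 = radial_second_partial[OF f f']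
  have P1: "partial_deriv i (\<lambda>y. (f (y \<bullet> y) *\<^sub>R y) $ j) =
    (\<lambda>x::real ^ 'n. 2 * f' (x \<bullet> x) * x $ i * x $ j + f (x \<bullet> x) * axis i 1 $ j)" for i j
    unfolding partial_deriv_def by (rule ext, rule DERIV_imp_deriv, rule D1)
  have P2: "partial_deriv i (\<lambda>x::real ^ 'n. 2 * f' (x \<bullet> x) * x $ i * x $ j + f (x \<bullet> x) * axis i 1 $ j) x =
    4 * f'' (x \<bullet> x) * (x $ i)^2 * x $ j + 2 * f' (x \<bullet> x) * (x $ j + x $ i * axis i 1 $ j)
             + 2 * f' (x \<bullet> x) * x $ i * axis i 1 $ j" for i j x
    unfolding partial_deriv_def by (rule DERIV_imp_deriv, rule D2)
  show ?E
    unfolding laplacian_exists_def P1 partial_deriv_exists_def field_differentiable_def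
    by (intro allI conjI exI, rule D1, rule D2)
  have sq: "(\<Sum>i\<in>UNIV. (x $ i)^2) = x \<bullet> x"
    by (simp add: inner_vec_def power2_eq_square)
  have ax: "(\<Sum>i\<in>UNIV. x $ i * axis i 1 $ j) = x $ j" for j
    by (simp add: axis_def if_distrib cong: if_cong)
  have "laplacian (\<lambda>y::real ^ 'n. f (y \<bullet> y) *\<^sub>R y) x $ j =
     4 * f'' (x \<bullet> x) * x $ j * (\<Sum>i\<in>UNIV. (x $ i)^2) + 2 * f' (x \<bullet> x) * (\<Sum>i\<in>(UNIV::'n set). x $ j)
      + 4 * f' (x \<bullet> x) * (\<Sum>i\<in>UNIV. x $ i * axis i 1 $ j)" for j
    unfolding laplacian_def P1 P2 sum_distrib_left sum.distrib[symmetric]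
    by (simp, intro sum.cong refl, simp add: algebra_simps)
  then show ?L
    unfolding sq ax by (simp add: vec_eq_iff algebra_simps)
qed

section \<open>The Cole--Hopf profile of the heat kernel\<close>

text \<open>
  With \<open>m = n/2\<close>, the weight is \<open>t\<close> divided by the scaled heat kernel
  \<open>t powr (-m) * exp (-q/(4\<mu>t)) / C\<close>. Putting the kernel in the denominator makes its
  derivatives multiples of the weight itself, so that all derivatives of the profile are
  polynomials in the profile and the weight.
\<close>

definition cole_weight :: "real \<Rightarrow> real \<Rightarrow> real \<Rightarrow> real \<Rightarrow> real \<Rightarrow> real" where
  "cole_weight \<mu> m C t q = C * t powr (m + 1) * exp (q / (4 * \<mu> * t))"

definition cole_profile :: "real \<Rightarrow> real \<Rightarrow> real \<Rightarrow> real \<Rightarrow> real \<Rightarrow> real" where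
  "cole_profile \<mu> m C t q = 1 / (t + cole_weight \<mu> m C t q)"

text \<open>
  Closed forms for the derivatives of the profile: the suffix names the variables of
  differentiation. Closed forms make joint continuity in \<open>(t, x)\<close> visible.
\<close>

definition cole_profile_q :: "real \<Rightarrow> real \<Rightarrow> real \<Rightarrow> real \<Rightarrow> real \<Rightarrow> real" where
  "cole_profile_q \<mu> m C t q =
     - ((cole_profile \<mu> m C t q)^2 * cole_weight \<mu> m C t q / (4 * \<mu> * t))"

definition cole_profile_qq :: "real \<Rightarrow> real \<Rightarrow> real \<Rightarrow> real \<Rightarrow> real \<Rightarrow> real" where
  "cole_profile_qq \<mu> m C t q =
     (2 * (cole_profile \<mu> m C t q)^3 * (cole_weight \<mu> m C t q)^2
       - ((cole_profile \<mu> m C t q)^2) * cole_weight \<mu> m C t q) / (4 * \<mu> * t)^2"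

definition cole_profile_t :: "real \<Rightarrow> real \<Rightarrow> real \<Rightarrow> real \<Rightarrow> real \<Rightarrow> real" where
  "cole_profile_t \<mu> m C t q = - ((cole_profile \<mu> m C t q)^2) *
     (1 + cole_weight \<mu> m C t q * ((m + 1) / t - q / (4 * \<mu> * t^2)))"

lemma weight_deriv_q:
  assumes "\<mu> > 0" "t > 0"
  shows "((\<lambda>q. cole_weight \<mu> m C t q) has_real_derivative cole_weight \<mu> m C t q / (4 * \<mu> * t)) (at q)"
  unfolding cole_weight_def using assms by (auto intro!: derivative_eq_intros simp: mult_ac)

lemma weight_deriv_t:
  assumes "\<mu> > 0" "t > 0"
  shows "((\<lambda>t. cole_weight \<mu> m C t q) has_real_derivative
     cole_weight \<mu> m C t q * ((m + 1) / t - q / (4 * \<mu> * t^2))) (at t)"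
proof -
  have e: "t powr (m + 1) = t powr m * t" using assms by (simp add: powr_add)
  show ?thesis
    unfolding cole_weight_def
    using assms by (auto intro!: derivative_eq_intros simp: e) (simp add: field_simps power2_eq_square)
qed

lemma den_pos: "C > 0 \<Longrightarrow> t > 0 \<Longrightarrow> t + cole_weight \<mu> m C t q > 0"
  by (simp add: cole_weight_def add_pos_pos)

lemma recip_deriv:
  assumes "(g has_real_derivative d) (at x)" "g x \<noteq> (0::real)"
  shows "((\<lambda>x. 1 / g x) has_real_derivative - ((1 / g x)^2 * d)) (at x)"
  using assms by (auto intro!: derivative_eq_intros simp: field_simps power2_eq_square)

lemma cole_profile_deriv_q:
  assumes "\<mu> > 0" "C > 0" "t > 0"
  shows "((\<lambda>q. cole_profile \<mu> m C t q) has_real_derivative cole_profile_q \<mu> m C t q) (at q)"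
proof -
  have "((\<lambda>q. t + cole_weight \<mu> m C t q) has_real_derivative cole_weight \<mu> m C t q / (4 * \<mu> * t)) (at q)"
    using DERIV_add[OF DERIV_const[of t] weight_deriv_q[OF assms(1,3)]] by simp
  from recip_deriv[OF this] den_pos[OF assms(2,3), of \<mu> m q] show ?thesis
    unfolding cole_profile_def cole_profile_q_def by simp
qed

lemma cole_profile_deriv_t:
  assumes "\<mu> > 0" "C > 0" "t > 0"
  shows "((\<lambda>t. cole_profile \<mu> m C t q) has_real_derivative cole_profile_t \<mu> m C t q) (at t)"
proof -
  have "((\<lambda>t. t + cole_weight \<mu> m C t q) has_real_derivative
      1 + cole_weight \<mu> m C t q * ((m + 1) / t - q / (4 * \<mu> * t^2))) (at t)"
    by (rule DERIV_add[OF DERIV_ident weight_deriv_t[OF assms(1,3)]])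
  from recip_deriv[OF this] den_pos[OF assms(2,3), of \<mu> m q] show ?thesis
    unfolding cole_profile_def cole_profile_t_def by simp
qed

lemma cole_profile_deriv_qq:
  assumes "\<mu> > 0" "C > 0" "t > 0"
  shows "((\<lambda>q. cole_profile_q \<mu> m C t q) has_real_derivative cole_profile_qq \<mu> m C t q) (at q)"
proof -
  note F = cole_profile_deriv_q[OF assms, of m q] and E = weight_deriv_q[OF assms(1,3), of m C q]
  have "((\<lambda>q. - ((cole_profile \<mu> m C t q)^2 * cole_weight \<mu> m C t q / (4 * \<mu> * t))) has_real_derivative
    - ((2 * cole_profile \<mu> m C t q * cole_profile_q \<mu> m C t q) * cole_weight \<mu> m C t q
        + (cole_profile \<mu> m C t q)^2 * (cole_weight \<mu> m C t q / (4 * \<mu> * t))) / (4 * \<mu> * t)) (at q)"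
    by (rule derivative_eq_intros F E refl | use assms in \<open>simp add: field_simps\<close>)+
  then show ?thesis
    unfolding cole_profile_q_def[abs_def] cole_profile_qq_def
    by (rule DERIV_cong)
       (use assms in \<open>simp add: cole_profile_q_def field_simps power2_eq_square power3_eq_cube\<close>)
qed

text \<open>
  This is the Cole system for \<open>u(t,x) = F(t,\<bar>x\<bar>\<^sup>2) x\<close>, divided by \<open>x\<close>: the left-hand side collects
  \<open>u\<^sub>t\<close> and \<open>(u \<bullet> \<nabla>)u\<close>, and \<open>4m + 4 = 2n + 4\<close>. The terms with \<open>m\<close> cancel because of the power
  \<open>t powr (m + 1)\<close> in the weight; what remains is a multiple of \<open>1 - F (t + E)\<close>, which vanishes by
  the definition of the profile.
\<close>

lemma cole_profile_equation:
  assumes "\<mu> > 0" "C > 0" "t > 0"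
  shows "cole_profile_t \<mu> m C t q + (cole_profile \<mu> m C t q)^2
      + 2 * q * cole_profile \<mu> m C t q * cole_profile_q \<mu> m C t q
    = \<mu> * (4 * q * cole_profile_qq \<mu> m C t q + (4 * m + 4) * cole_profile_q \<mu> m C t q)"
proof -
  define E where "E = cole_weight \<mu> m C t q"
  define F where "F = cole_profile \<mu> m C t q"
  have F: "F * (t + E) = 1"
    using den_pos[OF assms(2,3), of \<mu> m q] by (simp add: F_def E_def cole_profile_def)
  \<comment> \<open>Naming the reciprocals makes the claim a polynomial identity modulo the relations \<open>ak\<close>.\<close>
  define a where "a = 1 / t"
  define k where "k = 1 / (4 * \<mu> * t)"
  have ak: "4 * \<mu> * k = a" "F = a - a * F * E"
    using assms F by (auto simp: a_def k_def field_simps)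
  have "\<mu> * (4 * q * ((2 * F^3 * E^2 - F^2 * E) * k^2) + (4 * m + 4) * (- (F^2 * E * k)))
     = (4 * \<mu> * k) * (q * (2 * F^3 * E^2 - F^2 * E) * k - (m + 1) * (F^2 * E))"
    by (simp add: algebra_simps power2_eq_square)
  moreover have "- (F^2) * (1 + E * ((m + 1) * a - q * k * a)) + F^2 + 2 * q * F * (- (F^2 * E * k))
      - a * (q * (2 * F^3 * E^2 - F^2 * E) * k - (m + 1) * (F^2 * E))
      = 2 * q * F^2 * E * k * ((a - a * F * E) - F)"
    by (simp add: algebra_simps power2_eq_square power3_eq_cube)
  ultimately have "- (F^2) * (1 + E * ((m + 1) * a - q * k * a)) + F^2 + 2 * q * F * (- (F^2 * E * k))
      = \<mu> * (4 * q * ((2 * F^3 * E^2 - F^2 * E) * k^2) + (4 * m + 4) * (- (F^2 * E * k)))"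
    using ak by simp
  then show ?thesis
    unfolding cole_profile_t_def cole_profile_q_def cole_profile_qq_def E_def[symmetric] F_def[symmetric]
    by (simp add: a_def k_def power2_eq_square mult_ac)
qed

lemma cole_profile_continuous:
  fixes m :: real
  assumes "\<mu> > 0" "C > 0"
  defines "S \<equiv> {0<..} \<times> (UNIV :: (real^'n::finite) set)"
  shows "continuous_on S (\<lambda>z. cole_profile \<mu> m C (fst z) (snd z \<bullet> snd z))"
    and "continuous_on S (\<lambda>z. cole_profile_q \<mu> m C (fst z) (snd z \<bullet> snd z))"
    and "continuous_on S (\<lambda>z. cole_profile_qq \<mu> m C (fst z) (snd z \<bullet> snd z))"
    and "continuous_on S (\<lambda>z. cole_profile_t \<mu> m C (fst z) (snd z \<bullet> snd z))"
proof -
  have nz: "fst z + cole_weight \<mu> m C (fst z) (snd z \<bullet> snd z) \<noteq> 0" "fst z \<noteq> 0" if "z \<in> S" for z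
    using den_pos[of C "fst z" \<mu> m "snd z \<bullet> snd z"] that assms by (auto simp: S_def)
  have E: "continuous_on S (\<lambda>z. cole_weight \<mu> m C (fst z) (snd z \<bullet> snd z))"
    using assms(1) unfolding cole_weight_def by (auto intro!: continuous_intros simp: S_def)
  show F: "continuous_on S (\<lambda>z. cole_profile \<mu> m C (fst z) (snd z \<bullet> snd z))"
    unfolding cole_profile_def using nz by (intro continuous_intros E) auto
  show "continuous_on S (\<lambda>z. cole_profile_q \<mu> m C (fst z) (snd z \<bullet> snd z))"
    unfolding cole_profile_q_def using nz assms(1) by (intro continuous_intros E F) auto
  show "continuous_on S (\<lambda>z. cole_profile_qq \<mu> m C (fst z) (snd z \<bullet> snd z))"
    unfolding cole_profile_qq_def using nz assms(1) by (intro continuous_intros E F) auto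
  show "continuous_on S (\<lambda>z. cole_profile_t \<mu> m C (fst z) (snd z \<bullet> snd z))"
    unfolding cole_profile_t_def using nz assms(1) by (intro continuous_intros E F) auto
qed

section \<open>Gaussian integrals and elementary bounds\<close>

lemma nn_integral_gaussian:
  assumes "a > 0"
  shows "(\<integral>\<^sup>+x. ennreal (exp (- a * x^2)) \<partial>lborel) = ennreal (sqrt (pi / a))"
proof -
  \<comment> \<open>The integrand is a multiple of the normal density with variance \<open>1 / (2 * a)\<close>.\<close>
  define s where "s = sqrt (1 / (2 * a))"
  have s: "s > 0" "s^2 = 1 / (2 * a)" using assms by (auto simp: s_def)
  interpret prob_space "density lborel (normal_density 0 s)"
    using s by (intro prob_space_normal_density)
  have 1: "(\<integral>\<^sup>+x. ennreal (normal_density 0 s x) \<partial>lborel) = 1"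
    using emeasure_space_1 by (simp add: emeasure_density)
  have "2 * pi * s^2 = pi / a" "2 * s^2 = 1 / a" using assms by (simp_all add: s(2))
  then have "exp (- a * x^2) = sqrt (pi / a) * normal_density 0 s x" for x
    using assms by (simp add: normal_density_def mult.commute)
  then have "(\<integral>\<^sup>+x. ennreal (exp (- a * x^2)) \<partial>lborel)
    = (\<integral>\<^sup>+x. ennreal (sqrt (pi / a)) * ennreal (normal_density 0 s x) \<partial>lborel)"
    using assms by (simp add: ennreal_mult)
  also have "\<dots> = ennreal (sqrt (pi / a))"
    by (subst nn_integral_cmult) (auto simp: 1)
  finally show ?thesis .
qed

text \<open>
  The Gaussian of a sum of squares is a product of one-dimensional Gaussians, so the integral
  factors over the coordinates.
\<close>

lemma nn_integral_gaussian_euclidean: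
  assumes "a > 0"
  shows "(\<integral>\<^sup>+x. ennreal (exp (- a * (x \<bullet> x))) \<partial>(lebesgue :: 'a::euclidean_space measure))
    = ennreal (sqrt (pi / a) ^ DIM('a))"
proof -
  have "exp (- a * (x \<bullet> x)) = (\<Prod>b\<in>Basis. exp (- a * (x \<bullet> b)^2))" for x :: 'a
    unfolding exp_sum[OF finite_Basis, symmetric] sum_distrib_left[symmetric]
    by (subst euclidean_inner) (simp add: power2_eq_square)
  then have "(\<integral>\<^sup>+x. ennreal (exp (- a * (x \<bullet> x))) \<partial>(lebesgue :: 'a measure))
    = (\<integral>\<^sup>+x. (\<Prod>b\<in>Basis. ennreal (exp (- a * (x \<bullet> b)^2))) \<partial>(lborel :: 'a measure))"
    by (simp add: nn_integral_completion prod_ennreal)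
  also have "\<dots> = (\<Prod>b\<in>(Basis::'a set). \<integral>\<^sup>+x. ennreal (exp (- a * x^2)) \<partial>lborel)"
    by (subst nn_integral_lborel_prod) (auto)
  also have "\<dots> = ennreal (sqrt (pi / a) ^ DIM('a))"
    unfolding nn_integral_gaussian[OF assms] using assms by (simp add: ennreal_power)
  finally show ?thesis .
qed

text \<open>
  The interpolation that replaces the denominator \<open>1 + h\<close> by a small power of \<open>h\<close>; it
  trades a little of the power of \<open>t\<close> for Gaussian decay in space.
\<close>

lemma powr_le_one_plus:
  assumes "h > (0::real)" "0 \<le> \<theta>" "\<theta> \<le> 1"
  shows "h powr \<theta> \<le> 1 + h"
proof (cases "h \<le> 1")
  case True
  then have "h powr \<theta> \<le> 1" using assms by (intro powr_le1) auto
  then show ?thesis using assms by simp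
next
  case False
  then have "h powr \<theta> \<le> h powr 1" using assms by (intro powr_mono) auto
  then show ?thesis using False by simp
qed

lemma linear_times_gaussian_le:
  assumes "a > (0::real)"
  shows "r * exp (- a * r^2) \<le> 1 / sqrt a"
proof -
  define y where "y = sqrt a * r"
  have "0 \<le> (y - 1 / 2)^2" by simp
  then have "y \<le> 1 + y^2" by (simp add: power2_eq_square algebra_simps)
  also have "\<dots> \<le> exp (y^2)" by (rule exp_ge_add_one_self)
  finally have "y \<le> exp (a * r^2)" using assms by (simp add: y_def power_mult_distrib)
  then show ?thesis using assms by (simp add: y_def exp_minus field_simps)
qed

section \<open>Decay of the solutions as time tends to zero\<close>

text \<open>
  The interpolation leaves the factor \<open>h powr (-\<theta>)\<close>, whose Gaussian part is split into two equal
  halves: one absorbs the linear factor \<open>r\<close> at the cost of \<open>sqrt t\<close>, the other stays to make the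
  bound integrable.
\<close>

lemma cole_profile_bound:
  fixes r :: real
  assumes "\<mu> > 0" "C > 0" "t > 0" "0 < \<theta>" "\<theta> \<le> 1" "r \<ge> 0"
  shows "cole_profile \<mu> m C t (r^2) * r
     \<le> C powr (-\<theta>) * sqrt (8 * \<mu> / \<theta>) * t powr (- (1/2 + m * \<theta>)) * exp (- (\<theta> / (8 * \<mu> * t)) * r^2)"
proof -
  define h where "h = C * t powr m * exp (r^2 / (4 * \<mu> * t))"
  define a where "a = \<theta> / (8 * \<mu> * t)"
  have h: "h > 0" using assms by (simp add: h_def)
  have a: "a > 0" using assms by (simp add: a_def)
  have "cole_profile \<mu> m C t (r^2) = 1 / (t * (1 + h))"
    using assms by (simp add: cole_profile_def cole_weight_def h_def powr_add algebra_simps)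
  also have "\<dots> \<le> 1 / (t * h powr \<theta>)"
    using h assms powr_le_one_plus[OF h, of \<theta>] by (intro divide_left_mono mult_left_mono mult_pos_pos) auto
  also have "\<dots> = h powr (-\<theta>) / t" using assms by (simp add: powr_minus field_simps)
  also have "h powr (-\<theta>) = C powr (-\<theta>) * t powr (- (m * \<theta>)) * exp (- (2 * a) * r^2)"
    using assms by (simp add: h_def a_def powr_mult powr_powr exp_powr_real field_simps)
  also have "exp (- (2 * a) * r^2) = exp (- a * r^2) * exp (- a * r^2)"
    unfolding exp_add[symmetric] by simp
  finally have "cole_profile \<mu> m C t (r^2) * r \<le>
     C powr (-\<theta>) * t powr (- (m * \<theta>)) * (exp (- a * r^2) * exp (- a * r^2)) / t * r"
    using assms(6) by (rule mult_right_mono)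
  also have "\<dots> = (C powr (-\<theta>) * t powr (- (m * \<theta>)) * exp (- a * r^2) / t) * (r * exp (- a * r^2))"
    by simp
  also have "\<dots> \<le> (C powr (-\<theta>) * t powr (- (m * \<theta>)) * exp (- a * r^2) / t) * (1 / sqrt a)"
    using assms by (intro mult_left_mono linear_times_gaussian_le a) auto
  also have "1 / sqrt a = sqrt (8 * \<mu> / \<theta>) * t powr (1/2)"
    using assms by (simp add: a_def real_sqrt_divide real_sqrt_mult powr_half_sqrt)
  also have "(C powr (-\<theta>) * t powr (- (m * \<theta>)) * exp (- a * r^2) / t) * \<dots>
    = C powr (-\<theta>) * sqrt (8 * \<mu> / \<theta>) * (t powr (- (m * \<theta>)) * t powr (1/2) * t powr (-1)) * exp (- a * r^2)"
    using assms(3) powr_minus_divide[of t 1] by simp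
  also have "t powr (- (m * \<theta>)) * t powr (1/2) * t powr (-1) = t powr (- (1/2 + m * \<theta>))"
    unfolding powr_add[symmetric] by (rule arg_cong[where f="(powr) t"]) simp
  finally show ?thesis unfolding a_def .
qed

text \<open>
  The restriction to positive times fixes the values at \<open>t \<le> 0\<close>, so that distinct
  members of the family differ as solutions and not just as functions.
\<close>

definition cole_field :: "real \<Rightarrow> real \<Rightarrow> real \<Rightarrow> real ^ 'n::finite \<Rightarrow> real ^ 'n" where
  "cole_field \<mu> C = (\<lambda>t\<in>{0<..}. \<lambda>x. cole_profile \<mu> (real CARD('n) / 2) C t (x \<bullet> x) *\<^sub>R x)"

text \<open>
  The pointwise bound contributes \<open>t powr (-(1/2 + (n/2)\<theta>) p)\<close>, and the integral of the remaining
  Gaussian, of width proportional to \<open>sqrt t\<close>, contributes \<open>t powr (n/2)\<close>.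
\<close>

lemma cole_field_Lp_bound:
  fixes p :: real
  assumes "\<mu> > 0" "C > 0" "1 \<le> p" "0 < \<theta>" "\<theta> \<le> 1"
  obtains K where "\<And>t. t > 0 \<Longrightarrow>
    (\<integral>\<^sup>+x. ennreal (norm (cole_field \<mu> C t (x :: real ^ 'n::finite)) powr p) \<partial>lebesgue)
      \<le> ennreal (K * t powr (real CARD('n) / 2 - p / 2 - real CARD('n) / 2 * \<theta> * p))"
proof -
  define m where "m = real CARD('n) / 2"
  define A where "A = C powr (-\<theta>) * sqrt (8 * \<mu> / \<theta>)"
  define B where "B = 8 * pi * \<mu> / (p * \<theta>)"
  have AB: "A > 0" "B > 0" using assms by (auto simp: A_def B_def)
  show thesis
  proof (rule that)
    fix t :: real assume t: "t > 0"
    define a where "a = p * \<theta> / (8 * \<mu> * t)"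
    define L where "L = A powr p * t powr (- (p / 2 + m * \<theta> * p))"
    have a: "a > 0" using t assms by (simp add: a_def)
    have pointwise: "norm (cole_field \<mu> C t x) powr p \<le> L * exp (- a * (x \<bullet> x))" for x :: "real ^ 'n"
    proof -
      have "cole_profile \<mu> m C t (norm x ^ 2) \<ge> 0"
        using t assms by (simp add: cole_profile_def cole_weight_def)
      then have "norm (cole_field \<mu> C t x) = cole_profile \<mu> m C t (norm x ^ 2) * norm x"
        using t by (simp add: cole_field_def m_def power2_norm_eq_inner)
      also have "\<dots> \<le> A * t powr (- (1/2 + m * \<theta>)) * exp (- (\<theta> / (8 * \<mu> * t)) * norm x ^ 2)"
        unfolding A_def by (rule cole_profile_bound) (use assms t in auto)
      finally have "norm (cole_field \<mu> C t x) powr p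
        \<le> (A * t powr (- (1/2 + m * \<theta>)) * exp (- (\<theta> / (8 * \<mu> * t)) * norm x ^ 2)) powr p"
        using assms by (intro powr_mono2) auto
      also have "\<dots> = A powr p * t powr (- (1/2 + m * \<theta>) * p) * exp (- (\<theta> / (8 * \<mu> * t)) * norm x ^ 2 * p)"
        using AB t by (simp add: powr_mult powr_powr exp_powr_real)
      also have "\<dots> = L * exp (- a * (x \<bullet> x))"
        by (simp add: L_def a_def power2_norm_eq_inner algebra_simps)
      finally show ?thesis .
    qed
    have L: "L \<ge> 0" by (simp add: L_def)
    have "(\<integral>\<^sup>+x. ennreal (norm (cole_field \<mu> C t (x :: real ^ 'n)) powr p) \<partial>lebesgue)
       \<le> (\<integral>\<^sup>+x. ennreal L * ennreal (exp (- a * (x \<bullet> x))) \<partial>(lebesgue :: (real ^ 'n) measure))"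
      using pointwise L by (intro nn_integral_mono) (simp add: ennreal_mult[symmetric] del: ennreal_mult)
    also have "\<dots> = ennreal L * (\<integral>\<^sup>+x. ennreal (exp (- a * (x \<bullet> x))) \<partial>(lebesgue :: (real ^ 'n) measure))"
      by (intro nn_integral_cmult measurable_completion) simp
    also have "\<dots> = ennreal (L * sqrt (pi / a) ^ CARD('n))"
      unfolding nn_integral_gaussian_euclidean[OF a] using L a by (simp add: ennreal_mult)
    also have "sqrt (pi / a) ^ CARD('n) = (pi / a) powr m"
      using a by (simp add: m_def powr_half_sqrt[symmetric] powr_realpow[symmetric] powr_powr)
    also have "pi / a = B * t" using t assms by (simp add: a_def B_def field_simps)
    also have "L * (B * t) powr m = (A powr p * B powr m) * (t powr (- (p / 2 + m * \<theta> * p)) * t powr m)"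
      using AB t by (simp add: L_def powr_mult)
    also have "t powr (- (p / 2 + m * \<theta> * p)) * t powr m = t powr (m - p / 2 - m * \<theta> * p)"
      unfolding powr_add[symmetric] by (simp add: algebra_simps)
    finally show "(\<integral>\<^sup>+x. ennreal (norm (cole_field \<mu> C t (x :: real ^ 'n)) powr p) \<partial>lebesgue)
      \<le> ennreal ((A powr p * B powr m) * t powr (real CARD('n) / 2 - p / 2 - real CARD('n) / 2 * \<theta> * p))"
      unfolding m_def .
  qed
qed

lemma cole_field_Lp_tendsto_0:
  fixes p :: real
  assumes "\<mu> > 0" "C > 0" "1 \<le> p" "p < real CARD('n::finite)"
  shows "((\<lambda>t. \<integral>\<^sup>+x. ennreal (norm (cole_field \<mu> C t (x :: real ^ 'n)) powr p) \<partial>lebesgue) \<longlongrightarrow> 0) (at_right 0)"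
proof -
  define n where "n = real CARD('n)"
  have n: "n > 0" "p < n" using assms by (auto simp: n_def)
  \<comment> \<open>With this \<open>\<theta>\<close> the interpolation loses half of the available exponent \<open>(n - p) / 2\<close>.\<close>
  define \<theta> where "\<theta> = (n - p) / (2 * n * p)"
  have th: "0 < \<theta>" using n assms by (simp add: \<theta>_def)
  have "n - p \<le> 2 * n * p" using n assms(3) mult_left_mono[of 1 p n] mult_pos_pos[of n p] by linarith
  then have th1: "\<theta> \<le> 1" using n assms by (simp add: \<theta>_def)
  have e: "n / 2 - p / 2 - n / 2 * \<theta> * p = (n - p) / 4"
    using n assms by (simp add: \<theta>_def field_simps)
  obtain K where K: "\<And>t. t > 0 \<Longrightarrow>
    (\<integral>\<^sup>+x. ennreal (norm (cole_field \<mu> C t (x :: real ^ 'n)) powr p) \<partial>lebesgue)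
      \<le> ennreal (K * t powr ((n - p) / 4))"
    using cole_field_Lp_bound[OF assms(1-3) th th1, where 'n='n] unfolding n_def[symmetric] e by metis
  have "((\<lambda>t. K * t powr ((n - p) / 4)) \<longlongrightarrow> K * 0 powr ((n - p) / 4)) (at_right 0)"
    using n by (intro tendsto_intros) (auto simp: eventually_at_filter)
  then have lim: "((\<lambda>t. ennreal (K * t powr ((n - p) / 4))) \<longlongrightarrow> 0) (at_right 0)"
    using tendsto_ennrealI by fastforce
  show ?thesis
    by (rule tendsto_sandwich[OF _ _ tendsto_const lim])
       (auto simp: eventually_at_filter intro!: always_eventually K)
qed

section \<open>The family of solutions\<close>

lemma cole_field_acceptable:
  fixes p :: real
  assumes "\<mu> > 0" "C > 0" "1 \<le> p" "p < real CARD('n::finite)"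
  shows "Lp_acceptable_solution \<mu> p (\<lambda>_. 0) (cole_field \<mu> C :: real \<Rightarrow> real ^ 'n \<Rightarrow> real ^ 'n)"
proof -
  define m where "m = real CARD('n) / 2"
  let ?u = "cole_field \<mu> C :: real \<Rightarrow> real ^ 'n \<Rightarrow> real ^ 'n"
  let ?F = "cole_profile \<mu> m C" and ?Fq = "cole_profile_q \<mu> m C"
    and ?Fqq = "cole_profile_qq \<mu> m C" and ?Ft = "cole_profile_t \<mu> m C"
  let ?S = "{0<..} \<times> (UNIV :: (real ^ 'n) set)"
  have u: "?u t = (\<lambda>x. ?F t (x \<bullet> x) *\<^sub>R x)" if "t > 0" for t
    using that by (simp add: cole_field_def m_def)
  note Dq = cole_profile_deriv_q[OF assms(1,2), of _ m]
    and Dqq = cole_profile_deriv_qq[OF assms(1,2), of _ m]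
    and cont = cole_profile_continuous[OF assms(1,2), where 'n='n and m=m]
  have time: "((\<lambda>s. ?u s x) has_vector_derivative ?Ft t (x \<bullet> x) *\<^sub>R x) (at t)" if "t > 0" for t x
  proof (rule has_vector_derivative_transform_within_open[OF _ open_greaterThan[of 0]])
    show "((\<lambda>s. ?F s (x \<bullet> x) *\<^sub>R x) has_vector_derivative ?Ft t (x \<bullet> x) *\<^sub>R x) (at t)"
      using has_vector_derivative_scaleR[OF cole_profile_deriv_t[OF assms(1,2) that] has_vector_derivative_const[of x]]
      by simp
  qed (use that in \<open>auto simp: u\<close>)
  have vd: "vector_derivative (\<lambda>s. ?u s x) (at t) = ?Ft t (x \<bullet> x) *\<^sub>R x" if "t > 0" for t x
    using time[OF that] by (rule vector_derivative_at)
  have jac: "jacobian (?u t) (at x) = (\<chi> j i. ?F t (x \<bullet> x) * axis i 1 $ j + 2 * ?Fq t (x \<bullet> x) * x $ i * x $ j)"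
    if "t > 0" for t x
    unfolding u[OF that] by (rule radial_jacobian[OF Dq[OF that]])
  have lap: "laplacian (?u t) x
      = (4 * (x \<bullet> x) * ?Fqq t (x \<bullet> x) + (4 * m + 4) * ?Fq t (x \<bullet> x)) *\<^sub>R x" if "t > 0" for t x
    unfolding u[OF that] radial_laplacian[OF Dq[OF that] Dqq[OF that]] by (simp add: m_def)
  have "continuous_on ?S (\<lambda>(t, x). vector_derivative (\<lambda>s. ?u s x) (at t))"
  proof (rule continuous_on_eq)
    show "continuous_on ?S (\<lambda>z. ?Ft (fst z) (snd z \<bullet> snd z) *\<^sub>R snd z)"
      by (intro continuous_intros cont)
  qed (auto simp: vd)
  moreover have "continuous_on ?S (\<lambda>(t, x). jacobian (?u t) (at x))"
  proof (rule continuous_on_eq)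
    show "continuous_on ?S (\<lambda>z. \<chi> j i. ?F (fst z) (snd z \<bullet> snd z) * axis i 1 $ j
        + 2 * ?Fq (fst z) (snd z \<bullet> snd z) * snd z $ i * snd z $ j)"
      by (intro continuous_intros cont)
  qed (auto simp: jac)
  moreover have "continuous_on ?S (\<lambda>(t, x). laplacian (?u t) x)"
  proof (rule continuous_on_eq)
    show "continuous_on ?S (\<lambda>z. (4 * (snd z \<bullet> snd z) * ?Fqq (fst z) (snd z \<bullet> snd z)
        + (4 * m + 4) * ?Fq (fst z) (snd z \<bullet> snd z)) *\<^sub>R snd z)"
      by (intro continuous_intros cont)
  qed (auto simp: lap)
  moreover have "?u t differentiable (at x)" if "t > 0" for t x
    unfolding u[OF that] differentiable_def using radial_has_derivative[OF Dq[OF that]] by blast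
  moreover have "laplacian_exists (?u t)" if "t > 0" for t
    unfolding u[OF that] by (rule radial_laplacian_exists[OF Dq[OF that] Dqq[OF that]])
  moreover have "vector_derivative (\<lambda>s. ?u s x) (at t) + jacobian (?u t) (at x) *v ?u t x
      = \<mu> *\<^sub>R laplacian (?u t) x" if t: "t > 0" for t x
  proof -
    have "jacobian (?u t) (at x) *v ?u t x
      = ((?F t (x \<bullet> x))^2 + 2 * (x \<bullet> x) * ?F t (x \<bullet> x) * ?Fq t (x \<bullet> x)) *\<^sub>R x"
      unfolding u[OF t] radial_jacobian_mult[OF Dq[OF t]]
      by (simp add: scaleR_add_left power2_eq_square mult_ac)
    then show ?thesis
      unfolding vd[OF t] lap[OF t] scaleR_scaleR cole_profile_equation[OF assms(1,2) t, of m, symmetric]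
      by (simp add: scaleR_add_left)
  qed
  moreover have "(\<lambda>s. ?u s x) differentiable (at t)" if "t > 0" for t x
    using time[OF that] by (rule differentiableI_vector)
  ultimately show ?thesis
    unfolding Lp_acceptable_solution_def
    using assms(3) cole_field_Lp_tendsto_0[OF assms] by simp
qed

text \<open>
  Injectivity in \<open>C\<close> and non-triviality are both read off at time \<open>1\<close> and a unit vector.
\<close>

theorem proposition2p4:
  fixes \<mu> p :: real
  assumes "\<mu> > 0" and "CARD('n::finite) \<ge> 2" and "1 \<le> p" and "p < real CARD('n)"
  shows "infinite {u :: real \<Rightarrow> real ^ 'n \<Rightarrow> real ^ 'n. u \<in> extensional {0<..} \<and>
           Lp_acceptable_solution \<mu> p (\<lambda>_. 0) u \<and> (\<exists>t>0. \<exists>x. u t x \<noteq> 0)}" (is "infinite ?U")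
proof
  let ?u = "cole_field \<mu> :: real \<Rightarrow> real \<Rightarrow> real ^ 'n \<Rightarrow> real ^ 'n"
  define e where "e = (axis undefined 1 :: real ^ 'n)"
  have e: "e \<bullet> e = 1" "e \<noteq> 0" by (auto simp: e_def inner_axis_axis)
  have at1: "?u C 1 e = (1 / (1 + C * exp (1 / (4 * \<mu>)))) *\<^sub>R e" for C
    by (simp add: cole_field_def cole_profile_def cole_weight_def e)
  have pos: "1 + C * exp (1 / (4 * \<mu>)) > 0" if "C > 0" for C
    using that by (simp add: add_pos_pos)
  assume "finite ?U"
  moreover have "?u ` {0<..} \<subseteq> ?U"
  proof (intro image_subsetI CollectI conjI)
    fix C :: real assume C: "C \<in> {0<..}"
    show "?u C \<in> extensional {0<..}" by (simp add: cole_field_def)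
    show "Lp_acceptable_solution \<mu> p (\<lambda>_. 0) (?u C)"
      using C assms by (intro cole_field_acceptable) auto
    have "?u C 1 e \<noteq> 0" using pos[of C] C e by (simp add: at1)
    then show "\<exists>t>0. \<exists>x. ?u C t x \<noteq> 0" by (intro exI[of _ 1]) auto
  qed
  ultimately have "finite (?u ` {0<..})" by (rule rev_finite_subset)
  moreover have "inj_on ?u {0<..}"
  proof (rule inj_onI)
    fix C D :: real assume CD: "C \<in> {0<..}" "D \<in> {0<..}" "?u C = ?u D"
    then have "?u C 1 e = ?u D 1 e" by simp
    then have "1 + C * exp (1 / (4 * \<mu>)) = 1 + D * exp (1 / (4 * \<mu>))"
      using e(2) pos[of C] pos[of D] CD(1,2) by (simp add: at1 frac_eq_eq)
    then show "C = D" by simp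
  qed
  ultimately have "finite {0::real<..}" by (rule finite_imageD)
  then show False using infinite_Ioi by blast
qed
end
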